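(* Let $d\in\mathbb{N}$, let $\Omega\subset\mathbb{C}^d$ be a nonempty open set, and let $\mathcal{X}\subset\operatorname{Hol}(\Omega)$ be a Hausdorff topological vector space satisfying properties P1, P2, P3 (see context). Let $S=(S_1,\dots,S_d)$ be the tuple of shift operators on $\mathcal{X}$ and let $S^*=(S_1^*,\dots,S_d^* )$ be the tuple of their topological adjoints on $\mathcal{X}^*$. Then $$\Omega\subseteq\Omega_{max}=\sigma_p(S^* )\subseteq\sigma_R(S).$$
   Context: All vector spaces are over $\mathbb{C}$; topological vector spaces (TVS) are not assumed locally convex. $\operatorname{Hol}(\Omega)$ is the space of holomorphic functions on $\Omega$. $\mathcal{P}_d$ is the set of polynomials in $d$ complex variables, viewed (by restriction) as functions on $\Omega$. The properties are: P1: $\mathcal{P}_d\subset\mathcal{X}$ and $\mathcal{P}_d$ is dense in $\mathcal{X}$. P2: for each $w\in\Omega$ the evaluation functional $\Lambda_w(F)=F(w)$, $F\in\mathcal{X}$, is continuous. P3: for each $1\le j\le d$ the shift operator $S_jF(z)=z_jF(z)$ maps $\mathcal{X}$ to $\mathcal{X}$ and is continuous. $\mathcal{X}^*$ is the space of continuous linear functionals on $\mathcal{X}$ and $\mathcal{L}(\mathcal{X})$ the space of continuous linear maps $\mathcal{X}\to\mathcal{X}$. Maximal domain: $\Omega_{max}$ is the set of all $w\in\mathbb{C}^d$ such that the functional $P\mapsto P(w)$ on $\mathcal{P}_d$ extends to an element $\Lambda_w\in\mathcal{X}^*$. Topological adjoint: for $T\in\mathcal{L}(\mathcal{X})$, $T^*$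 acts on $\mathcal{X}^*$ by $(T^*\Lambda)(x)=\Lambda(Tx)$. Joint eigenvalues: for a $d$-tuple $T=(T_1,\dots,T_d)$ of linear operators on a vector space $\mathcal{Y}$, $\sigma_p(T)=\{w\in\mathbb{C}^d: \text{there is } 0\neq h\in\mathcal{Y}\text{ with }T_jh=w_jh\text{ for all }1\le j\le d\}$. Right Harte spectrum: for $T=(T_1,\dots,T_d)$ with $T_j\in\mathcal{L}(\mathcal{X})$, $\sigma_R(T)$ is the set of $w\in\mathbb{C}^d$ for which there do not exist $R_1,\dots,R_d\in\mathcal{L}(\mathcal{X})$ with $\sum_{j=1}^d(T_j-w_jI)R_j=I$. *)

theory Defs
  imports "HOL-Analysis.Analysis"
begin

text \<open>
  A function on a set \<open>\<Omega>\<close> is represented by its extension by zero to the whole type, so that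
  equality of functions on \<open>\<Omega>\<close> is HOL equality and the pointwise vector space operations
  need no relativisation. The same convention is used for functionals on a space of functions.
\<close>

definition zero_ext :: "'a set \<Rightarrow> ('a \<Rightarrow> complex) \<Rightarrow> 'a \<Rightarrow> complex" where
  "zero_ext A f = (\<lambda>z. if z \<in> A then f z else 0)"

text \<open>Holomorphic means Frechet differentiable with complex-linear derivative at every point.\<close>

definition Hol :: "(complex ^ 'd) set \<Rightarrow> (complex ^ 'd \<Rightarrow> complex) set" where
  "Hol \<Omega> = {f. (\<forall>z\<in>\<Omega>. \<exists>D. (f has_derivative D) (at z) \<and> (\<forall>c v. D (c *s v) = c * D v)) \<and>
               (\<forall>z. z \<notin> \<Omega> \<longrightarrow> f z = 0)}"

definition polynomials :: "(complex ^ 'd \<Rightarrow> complex) set" where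
  "polynomials = {p. \<exists>(A :: ('d \<Rightarrow> nat) set) c. finite A \<and>
                     p = (\<lambda>z. \<Sum>\<alpha>\<in>A. c \<alpha> * (\<Prod>j\<in>UNIV. (z $ j) ^ \<alpha> j))}"

text \<open>
  A topological vector space of functions is given by its topology; its carrier is the
  \<^const>\<open>topspace\<close>. No separation axiom is included.
\<close>

definition complex_tvs :: "('a \<Rightarrow> complex) topology \<Rightarrow> bool" where
  "complex_tvs X \<longleftrightarrow>
     (\<lambda>_. 0) \<in> topspace X \<and>
     (\<forall>F\<in>topspace X. \<forall>G\<in>topspace X. (\<lambda>z. F z + G z) \<in> topspace X) \<and>
     (\<forall>c. \<forall>F\<in>topspace X. (\<lambda>z. c * F z) \<in> topspace X) \<and>
     continuous_map (prod_topology X X) X (\<lambda>(F, G). (\<lambda>z. F z + G z)) \<and>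
     continuous_map (prod_topology euclidean X) X (\<lambda>(c, F). (\<lambda>z. c * F z))"

definition dual :: "('a \<Rightarrow> complex) topology \<Rightarrow> (('a \<Rightarrow> complex) \<Rightarrow> complex) set" where
  "dual X = {\<Lambda>. continuous_map X euclidean \<Lambda> \<and>
     (\<forall>F\<in>topspace X. \<forall>G\<in>topspace X. \<Lambda> (\<lambda>z. F z + G z) = \<Lambda> F + \<Lambda> G) \<and>
     (\<forall>c. \<forall>F\<in>topspace X. \<Lambda> (\<lambda>z. c * F z) = c * \<Lambda> F) \<and>
     (\<forall>F. F \<notin> topspace X \<longrightarrow> \<Lambda> F = 0)}"

text \<open>Operators are unconstrained off the carrier; only their restriction to it is relevant.\<close>

definition cont_ops :: "('a \<Rightarrow> complex) topology \<Rightarrow> (('a \<Rightarrow> complex) \<Rightarrow> 'a \<Rightarrow> complex) set" where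
  "cont_ops X = {T. continuous_map X X T \<and>
     (\<forall>F\<in>topspace X. \<forall>G\<in>topspace X. T (\<lambda>z. F z + G z) = (\<lambda>z. T F z + T G z)) \<and>
     (\<forall>c. \<forall>F\<in>topspace X. T (\<lambda>z. c * F z) = (\<lambda>z. c * T F z))}"

definition adjoint_op ::
  "('a \<Rightarrow> complex) topology \<Rightarrow> (('a \<Rightarrow> complex) \<Rightarrow> 'a \<Rightarrow> complex) \<Rightarrow>
   (('a \<Rightarrow> complex) \<Rightarrow> complex) \<Rightarrow> ('a \<Rightarrow> complex) \<Rightarrow> complex" where
  "adjoint_op X T \<Lambda> = zero_ext (topspace X) (\<lambda>F. \<Lambda> (T F))"

definition joint_eigenvalues ::
  "('a \<Rightarrow> complex) set \<Rightarrow> ('d \<Rightarrow> ('a \<Rightarrow> complex) \<Rightarrow> 'a \<Rightarrow> complex) \<Rightarrow> (complex ^ 'd) set" where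
  "joint_eigenvalues Y T =
     {w. \<exists>h\<in>Y. h \<noteq> (\<lambda>_. 0) \<and> (\<forall>j. T j h = (\<lambda>x. w $ j * h x))}"

definition right_Harte_spectrum ::
  "('a \<Rightarrow> complex) topology \<Rightarrow> ('d \<Rightarrow> ('a \<Rightarrow> complex) \<Rightarrow> 'a \<Rightarrow> complex) \<Rightarrow> (complex ^ 'd) set" where
  "right_Harte_spectrum X T =
     {w. \<not> (\<exists>R. (\<forall>j. R j \<in> cont_ops X) \<and>
               (\<forall>F\<in>topspace X. (\<lambda>z. \<Sum>j\<in>UNIV. (T j (R j F) z - w $ j * R j F z)) = F))}"

definition shift_op :: "'d \<Rightarrow> (complex ^ 'd \<Rightarrow> complex) \<Rightarrow> complex ^ 'd \<Rightarrow> complex" where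
  "shift_op j F = (\<lambda>z. z $ j * F z)"

definition property_P1 ::
  "(complex ^ 'd) set \<Rightarrow> (complex ^ 'd \<Rightarrow> complex) topology \<Rightarrow> bool" where
  "property_P1 \<Omega> X \<longleftrightarrow> zero_ext \<Omega> ` polynomials \<subseteq> topspace X \<and>
     X closure_of (zero_ext \<Omega> ` polynomials) = topspace X"

definition property_P2 ::
  "(complex ^ 'd) set \<Rightarrow> (complex ^ 'd \<Rightarrow> complex) topology \<Rightarrow> bool" where
  "property_P2 \<Omega> X \<longleftrightarrow> (\<forall>w\<in>\<Omega>. continuous_map X euclidean (\<lambda>F. F w))"

definition property_P3 :: "(complex ^ 'd \<Rightarrow> complex) topology \<Rightarrow> bool" where
  "property_P3 X \<longleftrightarrow> (\<forall>j. shift_op j ` topspace X \<subseteq> topspace X \<and> continuous_map X X (shift_op j))"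

definition Omega_max ::
  "(complex ^ 'd) set \<Rightarrow> (complex ^ 'd \<Rightarrow> complex) topology \<Rightarrow> (complex ^ 'd) set" where
  "Omega_max \<Omega> X = {w. \<exists>\<Lambda>\<in>dual X. \<forall>p\<in>polynomials. \<Lambda> (zero_ext \<Omega> p) = p w}"

end

theory Submission
  imports Defs
begin

text \<open>
  A joint eigenfunctional \<open>h\<close> of the adjoint shifts with eigenvalue \<open>w\<close> satisfies
  \<open>h p = p w * h 1\<close> for every polynomial \<open>p\<close>. By density \<open>h 1 \<noteq> 0\<close>, so \<open>h / h 1\<close> extends
  evaluation at \<open>w\<close>; conversely, by density, a continuous extension of evaluation at \<open>w\<close> is a
  joint eigenfunctional. Such an \<open>h\<close> annihilates the range of every \<open>S\<^sub>j - w\<^sub>j I\<close>, which rules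
  out a right inverse.
\<close>

section \<open>Polynomials and induction over them\<close>

lemma one_in_polynomials: "(\<lambda>_. 1) \<in> (polynomials :: (complex ^ 'd \<Rightarrow> complex) set)"
  unfolding polynomials_def
  by (intro CollectI exI[of _ "{\<lambda>_. 0}"] exI[of _ "\<lambda>_. 1"]) auto

text \<open>Multiplication by a coordinate only raises one exponent in every monomial, so the
  polynomial is reindexed along an injection of exponents and keeps its coefficients.\<close>

lemma coord_mult_in_polynomials:
  fixes p :: "complex ^ 'd \<Rightarrow> complex"
  assumes "p \<in> polynomials"
  shows "(\<lambda>z. z $ j * p z) \<in> polynomials"
proof -
  obtain A :: "('d \<Rightarrow> nat) set" and c where A: "finite A"
    and p: "p = (\<lambda>z. \<Sum>\<alpha>\<in>A. c \<alpha> * (\<Prod>i\<in>UNIV. (z $ i) ^ \<alpha> i))"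
    using assms unfolding polynomials_def by blast
  define up where "up = (\<lambda>\<alpha> :: 'd \<Rightarrow> nat. \<alpha>(j := Suc (\<alpha> j)))"
  \<comment> \<open>A left inverse of \<open>up\<close>, which gives injectivity and also carries
    the coefficients to the new exponents. It is evaluated only on the image of \<open>up\<close>,
    where the exponent at \<open>j\<close> is positive and the subtraction does not
    truncate.\<close>
  define down where "down = (\<lambda>\<alpha> :: 'd \<Rightarrow> nat. \<alpha>(j := \<alpha> j - 1))"
  have down_up: "down (up \<alpha>) = \<alpha>" for \<alpha>
    by (simp add: up_def down_def)
  have inj: "inj_on up A"
    by (rule inj_on_inverseI[where g = down]) (rule down_up)
  have mono: "(\<Prod>i\<in>UNIV. (z $ i) ^ up \<alpha> i) = z $ j * (\<Prod>i\<in>UNIV. (z $ i) ^ \<alpha> i)"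
    for z :: "complex ^ 'd" and \<alpha>
  proof -
    have "(\<Prod>i\<in>UNIV - {j}. (z $ i) ^ up \<alpha> i) = (\<Prod>i\<in>UNIV - {j}. (z $ i) ^ \<alpha> i)"
      by (intro prod.cong) (auto simp: up_def)
    then show ?thesis
      by (simp add: prod.remove[of UNIV j] up_def mult.assoc)
  qed
  have "(\<lambda>z. z $ j * p z) =
        (\<lambda>z. \<Sum>\<beta>\<in>up ` A. c (down \<beta>) * (\<Prod>i\<in>UNIV. (z $ i) ^ \<beta> i))"
    by (simp add: p sum.reindex[OF inj] down_up mono sum_distrib_left mult.left_commute)
  then show ?thesis
    unfolding polynomials_def using finite_imageI[OF A, of up]
    by (intro CollectI exI[of _ "up ` A"] exI[of _ "\<lambda>\<beta>. c (down \<beta>)"] conjI)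
qed

text \<open>The constant 1 generates all polynomials under these three operations. They are the ones
  a joint eigenfunctional respects: linear combinations by linearity, coordinate multiplication by
  the eigenvalue equation.\<close>

lemma polynomials_induct [consumes 1, case_names one coord_mult add scale]:
  fixes p :: "complex ^ 'd \<Rightarrow> complex"
  assumes p: "p \<in> polynomials"
    and one: "P (\<lambda>_. 1)"
    and coord_mult: "\<And>j q. P q \<Longrightarrow> P (\<lambda>z. z $ j * q z)"
    and add: "\<And>q r. P q \<Longrightarrow> P r \<Longrightarrow> P (\<lambda>z. q z + r z)"
    and scale: "\<And>c q. P q \<Longrightarrow> P (\<lambda>z. c * q z)"
  shows "P p"
proof -
  obtain A :: "('d \<Rightarrow> nat) set" and c where A: "finite A"
    and p: "p = (\<lambda>z. \<Sum>\<alpha>\<in>A. c \<alpha> * (\<Prod>i\<in>UNIV. (z $ i) ^ \<alpha> i))"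
    using p unfolding polynomials_def by blast
  \<comment> \<open>The extra factor \<open>q\<close> lets monomials be built one coordinate at a
    time, starting from the empty product 1.\<close>
  have power: "P (\<lambda>z. (z $ j) ^ n * q z)" if "P q" for j n q
  proof (induction n)
    case 0
    then show ?case using that by simp
  next
    case (Suc n)
    then show ?case using coord_mult[OF Suc, of j] by (simp add: mult.assoc)
  qed
  have monomial: "P (\<lambda>z. \<Prod>i\<in>J. (z $ i) ^ \<alpha> i)" if "finite J" for J and \<alpha> :: "'d \<Rightarrow> nat"
    using that by (induction J rule: finite_induct) (simp_all add: one power)
  have zero: "P (\<lambda>_. 0)"
    using scale[OF one, of 0] by simp
  show ?thesis
    unfolding p using A
    by (induction A rule: finite_induct) (simp_all add: zero add scale monomial)
qed

section \<open>Zero extension and continuous linear functionals\<close>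

lemma shift_op_zero_ext: "shift_op j (zero_ext \<Omega> p) = zero_ext \<Omega> (\<lambda>z. z $ j * p z)"
  by (auto simp: shift_op_def zero_ext_def)

lemma zero_ext_add: "zero_ext A (\<lambda>z. f z + g z) = (\<lambda>z. zero_ext A f z + zero_ext A g z)"
  by (auto simp: zero_ext_def)

lemma zero_ext_scale: "zero_ext A (\<lambda>z. c * f z) = (\<lambda>z. c * zero_ext A f z)"
  by (auto simp: zero_ext_def)

lemma continuous_map_complex_mult_left:
  fixes f :: "'a \<Rightarrow> complex"
  shows "continuous_map X euclidean f \<Longrightarrow> continuous_map X euclidean (\<lambda>x. c * f x)"
  by (simp add: continuous_map_atin tendsto_mult)

lemma dual_continuous: "h \<in> dual X \<Longrightarrow> continuous_map X euclidean h"
  and dual_add: "h \<in> dual X \<Longrightarrow> F \<in> topspace X \<Longrightarrow> G \<in> topspace X \<Longrightarrow>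
    h (\<lambda>z. F z + G z) = h F + h G"
  and dual_scale: "h \<in> dual X \<Longrightarrow> F \<in> topspace X \<Longrightarrow> h (\<lambda>z. c * F z) = c * h F"
  and dual_outside: "h \<in> dual X \<Longrightarrow> F \<notin> topspace X \<Longrightarrow> h F = 0"
  by (auto simp: dual_def)

lemma complex_tvs_zero: "complex_tvs X \<Longrightarrow> (\<lambda>_. 0) \<in> topspace X"
  and complex_tvs_add: "complex_tvs X \<Longrightarrow> F \<in> topspace X \<Longrightarrow> G \<in> topspace X \<Longrightarrow>
    (\<lambda>z. F z + G z) \<in> topspace X"
  and complex_tvs_scale: "complex_tvs X \<Longrightarrow> F \<in> topspace X \<Longrightarrow> (\<lambda>z. c * F z) \<in> topspace X"
  by (auto simp: complex_tvs_def)

text \<open>Membership of the sum is proved together with additivity, because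
  \<open>dual_add\<close> applies only once the partial sum is known to lie in the carrier.\<close>

lemma dual_sum:
  assumes "complex_tvs X" and "h \<in> dual X" and "finite J"
    and "\<And>j. j \<in> J \<Longrightarrow> F j \<in> topspace X"
  shows "(\<lambda>z. \<Sum>j\<in>J. F j z) \<in> topspace X \<and> h (\<lambda>z. \<Sum>j\<in>J. F j z) = (\<Sum>j\<in>J. h (F j))"
  using assms(3,4)
proof (induction J rule: finite_induct)
  case empty
  then show ?case
    using complex_tvs_zero[OF assms(1)] dual_scale[OF assms(2) complex_tvs_zero[OF assms(1)], of 0]
    by simp
next
  case (insert j J)
  then show ?case
    using complex_tvs_add[OF assms(1), of "F j"] dual_add[OF assms(2), of "F j"] by simp
qed

text \<open>Continuous maps into the Hausdorff space of complex numbers that agree on a set agree on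
  its closure; by P1 the closure of the polynomials is the whole carrier.\<close>

lemma property_P1_eqI:
  fixes f g :: "(complex ^ 'd \<Rightarrow> complex) \<Rightarrow> complex"
  assumes "property_P1 \<Omega> X"
    and "continuous_map X euclidean f" and "continuous_map X euclidean g"
    and "\<And>p. p \<in> polynomials \<Longrightarrow> f (zero_ext \<Omega> p) = g (zero_ext \<Omega> p)"
    and "F \<in> topspace X"
  shows "f F = g F"
proof (rule forall_in_closure_of_eq[OF _ _ assms(2,3)])
  show "F \<in> X closure_of (zero_ext \<Omega> ` polynomials)"
    using assms(1,5) by (simp add: property_P1_def)
  show "Hausdorff_space (euclidean :: complex topology)"
    by simp
qed (use assms(4) in auto)

text \<open>The adjoint is cut off to 0 outside the carrier, so the equation between functionals
  yields the pointwise one for \<open>F\<close> in the carrier.\<close>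

lemma adjoint_shift_eigen:
  assumes "adjoint_op X (shift_op j) h = (\<lambda>F. c * h F)" and "F \<in> topspace X"
  shows "h (shift_op j F) = c * h F"
  using fun_cong[OF assms(1), of F] assms(2) by (simp add: adjoint_op_def zero_ext_def)

section \<open>Maximal domain, joint eigenvalues and right spectrum\<close>

lemma Omega_subset_Omega_max:
  assumes "property_P1 \<Omega> X" and "property_P2 \<Omega> X" and tvs: "complex_tvs X"
  shows "\<Omega> \<subseteq> Omega_max \<Omega> X"
proof
  fix w assume w: "w \<in> \<Omega>"
  \<comment> \<open>Evaluation at \<open>w\<close> must be cut off outside the carrier, as members
    of \<open>dual X\<close> vanish there; continuity depends only on the values on the
    carrier.\<close>
  define \<Lambda> where "\<Lambda> = zero_ext (topspace X) (\<lambda>F. F w)"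
  have "continuous_map X euclidean (\<lambda>F. F w)"
    using assms(2) w by (simp add: property_P2_def)
  then have "continuous_map X euclidean \<Lambda>"
    by (rule continuous_map_eq) (simp add: \<Lambda>_def zero_ext_def)
  then have "\<Lambda> \<in> dual X"
    using complex_tvs_add[OF tvs] complex_tvs_scale[OF tvs]
    by (simp add: dual_def \<Lambda>_def zero_ext_def)
  moreover have "\<Lambda> (zero_ext \<Omega> p) = p w" if "p \<in> polynomials" for p
  proof -
    have "zero_ext \<Omega> p \<in> topspace X"
      using assms(1) that by (auto simp: property_P1_def)
    then have "\<Lambda> (zero_ext \<Omega> p) = zero_ext \<Omega> p w"
      by (simp add: \<Lambda>_def zero_ext_def[of "topspace X"])
    then show ?thesis
      using w by (simp add: zero_ext_def)
  qed
  ultimately show "w \<in> Omega_max \<Omega> X"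
    unfolding Omega_max_def by blast
qed

lemma Omega_max_subset_joint_eigenvalues:
  assumes P1: "property_P1 \<Omega> X" and P3: "property_P3 X"
  shows "Omega_max \<Omega> X \<subseteq> joint_eigenvalues (dual X) (\<lambda>j. adjoint_op X (shift_op j))"
proof
  fix w assume "w \<in> Omega_max \<Omega> X"
  then obtain h where h: "h \<in> dual X" and hp: "\<And>p. p \<in> polynomials \<Longrightarrow> h (zero_ext \<Omega> p) = p w"
    unfolding Omega_max_def by blast
  \<comment> \<open>Both sides are continuous in \<open>F\<close>. At a polynomial \<open>p\<close>
    both equal \<open>w $ j * p w\<close>, since the shift of \<open>p\<close> is again a
    polynomial; density does the rest.\<close>
  have "h (shift_op j F) = w $ j * h F" if "F \<in> topspace X" for j F
  proof (rule property_P1_eqI[OF P1 _ _ _ that, where f = "\<lambda>F. h (shift_op j F)"])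
    have "continuous_map X X (shift_op j)"
      using P3 by (simp add: property_P3_def)
    from continuous_map_compose[OF this dual_continuous[OF h]]
    show "continuous_map X euclidean (\<lambda>F. h (shift_op j F))"
      by (simp add: o_def)
    show "continuous_map X euclidean (\<lambda>F. w $ j * h F)"
      by (intro continuous_map_complex_mult_left dual_continuous[OF h])
  qed (simp add: shift_op_zero_ext hp coord_mult_in_polynomials)
  then have "adjoint_op X (shift_op j) h = (\<lambda>F. w $ j * h F)" for j
    by (auto simp: adjoint_op_def zero_ext_def dual_outside[OF h])
  \<comment> \<open>The value of \<open>h\<close> at the constant 1 is 1.\<close>
  moreover have "h \<noteq> (\<lambda>_. 0)"
    using hp[OF one_in_polynomials] by auto
  ultimately show "w \<in> joint_eigenvalues (dual X) (\<lambda>j. adjoint_op X (shift_op j))"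
    unfolding joint_eigenvalues_def using h by blast
qed

lemma joint_eigenvalues_subset_Omega_max:
  assumes tvs: "complex_tvs X" and P1: "property_P1 \<Omega> X" and P3: "property_P3 X"
  shows "joint_eigenvalues (dual X) (\<lambda>j. adjoint_op X (shift_op j)) \<subseteq> Omega_max \<Omega> X"
proof
  fix w assume "w \<in> joint_eigenvalues (dual X) (\<lambda>j. adjoint_op X (shift_op j))"
  then obtain h where h: "h \<in> dual X" and h0: "h \<noteq> (\<lambda>_. 0)"
    and "\<And>j. adjoint_op X (shift_op j) h = (\<lambda>F. w $ j * h F)"
    unfolding joint_eigenvalues_def by blast
  then have eig: "h (shift_op j F) = w $ j * h F" if "F \<in> topspace X" for j F
    using adjoint_shift_eigen that by blast
  define a where "a = h (zero_ext \<Omega> (\<lambda>_. 1))"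
  have one: "zero_ext \<Omega> (\<lambda>_. 1) \<in> topspace X"
    using P1 one_in_polynomials by (auto simp: property_P1_def)
  have hp: "h (zero_ext \<Omega> p) = p w * a" if "p \<in> polynomials" for p
  proof -
    \<comment> \<open>The induction carries membership along, since the eigenvalue equation and the
      linearity of \<open>h\<close> hold only on the carrier.\<close>
    from that have "zero_ext \<Omega> p \<in> topspace X \<and> h (zero_ext \<Omega> p) = p w * a"
    proof (induction rule: polynomials_induct)
      case one
      show ?case using \<open>zero_ext \<Omega> (\<lambda>_. 1) \<in> topspace X\<close> by (simp add: a_def)
    next
      case (coord_mult j q)
      moreover from this have "shift_op j (zero_ext \<Omega> q) \<in> topspace X"
        using P3 by (auto simp: property_P3_def)
      ultimately show ?case
        using eig[of "zero_ext \<Omega> q" j] by (simp add: shift_op_zero_ext)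
    next
      case (add q r)
      then show ?case
        by (simp add: zero_ext_add complex_tvs_add[OF tvs] dual_add[OF h] distrib_right)
    next
      case (scale c q)
      then show ?case
        by (simp add: zero_ext_scale complex_tvs_scale[OF tvs] dual_scale[OF h])
    qed
    then show ?thesis ..
  qed
  \<comment> \<open>Otherwise \<open>h\<close> vanishes on all polynomials, hence on the carrier by
    density, and off it by the convention in \<open>dual\<close>.\<close>
  have "a \<noteq> 0"
  proof
    assume "a = 0"
    then have "h F = 0" if "F \<in> topspace X" for F
      using property_P1_eqI[OF P1 dual_continuous[OF h] _ _ that, of "\<lambda>_. 0"] hp by simp
    then show False
      using h0 dual_outside[OF h] by blast
  qed
  define \<Lambda> where "\<Lambda> = (\<lambda>F. inverse a * h F)"
  have "continuous_map X euclidean \<Lambda>"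
    unfolding \<Lambda>_def by (intro continuous_map_complex_mult_left dual_continuous[OF h])
  then have "\<Lambda> \<in> dual X"
    by (simp add: dual_def \<Lambda>_def dual_add[OF h] dual_scale[OF h] dual_outside[OF h]
        distrib_left mult.left_commute)
  moreover have "\<Lambda> (zero_ext \<Omega> p) = p w" if "p \<in> polynomials" for p
    using \<open>a \<noteq> 0\<close> by (simp add: \<Lambda>_def hp[OF that])
  ultimately show "w \<in> Omega_max \<Omega> X"
    unfolding Omega_max_def by blast
qed

lemma joint_eigenvalues_subset_right_Harte_spectrum:
  assumes tvs: "complex_tvs X" and P3: "property_P3 X"
  shows "joint_eigenvalues (dual X) (\<lambda>j. adjoint_op X (shift_op j)) \<subseteq> right_Harte_spectrum X shift_op"
proof
  fix w assume "w \<in> joint_eigenvalues (dual X) (\<lambda>j. adjoint_op X (shift_op j))"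
  then obtain h where h: "h \<in> dual X" and h0: "h \<noteq> (\<lambda>_. 0)"
    and "\<And>j. adjoint_op X (shift_op j) h = (\<lambda>F. w $ j * h F)"
    unfolding joint_eigenvalues_def by blast
  then have eig: "h (shift_op j F) = w $ j * h F" if "F \<in> topspace X" for j F
    using adjoint_shift_eigen that by blast
  have False if R: "\<And>j. R j \<in> cont_ops X"
    and inv: "\<And>F. F \<in> topspace X \<Longrightarrow>
      (\<lambda>z. \<Sum>j\<in>UNIV. (shift_op j (R j F) z - w $ j * R j F z)) = F" for R
  proof -
    have "h F = 0" if F: "F \<in> topspace X" for F
    proof -
      \<comment> \<open>The difference is written as a sum with a scalar multiple, so that closure
        of the carrier and linearity of \<open>h\<close> apply directly. The eigenvalue equation
        then makes \<open>h\<close> vanish on each \<open>G j\<close>, while the \<open>G j\<close>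
        add up to \<open>F\<close>.\<close>
      define G where "G = (\<lambda>j z. shift_op j (R j F) z + (- w $ j) * R j F z)"
      have RF: "R j F \<in> topspace X" for j
        using R[of j] F by (auto simp: cont_ops_def continuous_map_def)
      then have SRF: "shift_op j (R j F) \<in> topspace X" for j
        using P3 by (auto simp: property_P3_def)
      have "G j \<in> topspace X" for j
        unfolding G_def by (intro complex_tvs_add complex_tvs_scale tvs RF SRF)
      then have "h (\<lambda>z. \<Sum>j\<in>UNIV. G j z) = (\<Sum>j\<in>UNIV. h (G j))"
        using dual_sum[OF tvs h, of UNIV G] by simp
      moreover have "h (G j) = 0" for j
        unfolding G_def
        by (subst dual_add[OF h SRF complex_tvs_scale[OF tvs RF]],
            subst dual_scale[OF h RF]) (simp add: eig[OF RF])
      moreover have "(\<lambda>z. \<Sum>j\<in>UNIV. G j z) = F"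
        using inv[OF F] by (simp add: G_def)
      ultimately show ?thesis by simp
    qed
    then show False
      using h0 dual_outside[OF h] by blast
  qed
  then show "w \<in> right_Harte_spectrum X shift_op"
    unfolding right_Harte_spectrum_def by blast
qed

theorem theorem2p1:
  fixes \<Omega> :: "(complex ^ 'd) set"
    and X :: "(complex ^ 'd \<Rightarrow> complex) topology"
  assumes "open \<Omega>" and "\<Omega> \<noteq> {}"
    and "topspace X \<subseteq> Hol \<Omega>"
    and "complex_tvs X" and "Hausdorff_space X"
    and "property_P1 \<Omega> X" and "property_P2 \<Omega> X" and "property_P3 X"
  shows "\<Omega> \<subseteq> Omega_max \<Omega> X \<and>
         Omega_max \<Omega> X = joint_eigenvalues (dual X) (\<lambda>j. adjoint_op X (shift_op j)) \<and>
         joint_eigenvalues (dual X) (\<lambda>j. adjoint_op X (shift_op j)) \<subseteq> right_Harte_spectrum X shift_op"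
  using Omega_subset_Omega_max[OF assms(6,7,4)]
    Omega_max_subset_joint_eigenvalues[OF assms(6,8)]
    joint_eigenvalues_subset_Omega_max[OF assms(4,6,8)]
    joint_eigenvalues_subset_right_Harte_spectrum[OF assms(4,8)]
  by (intro conjI subset_antisym)

end
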